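(* ${\rm fasd}(5,4)<4$, ${\rm fasd}(4,6)<6$, and ${\rm fasd}(3,9)<9$.
   Context: An oriented graph is a digraph without loops, multiple arcs or directed $2$-cycles. Degree = in-degree + out-degree; directed girth = minimum length of a directed cycle ($\infty$ if none). For a digraph $D$, ${\rm fasd}(D)$ is the maximum number $t$ such that $A(D)$ can be partitioned into $t$ feedback arc sets (sets of arcs whose removal makes $D$ acyclic), with ${\rm fasd}(D)=\infty$ if $D$ is acyclic. ${\rm fasd}(\Delta,g)$ is the minimum of ${\rm fasd}(D)$ over all oriented graphs $D$ with maximum degree at most $\Delta$ and directed girth at least $g$. *)

theory Defs
  imports
    "Graph_Theory.Pair_Digraph"
    "HOL-Library.Extended_Nat"
    "HOL-Library.Disjoint_Sets"
begin

text \<open>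
  The locale \<^locale>\<open>digraph\<close> provides finiteness and excludes loops and parallel arcs.
\<close>

locale oriented_graph = digraph +
  assumes no_2_cycles: "(u, v) \<in> arcs_ends G \<Longrightarrow> (v, u) \<notin> arcs_ends G"

definition degree :: "('a, 'b) pre_digraph \<Rightarrow> 'a \<Rightarrow> nat" where
  "degree G v = in_degree G v + out_degree G v"

definition directed_girth :: "('a, 'b) pre_digraph \<Rightarrow> enat" where
  "directed_girth G = (INF p \<in> {p. pre_digraph.cycle G p}. enat (length p))"

definition acyclic_digraph :: "('a, 'b) pre_digraph \<Rightarrow> bool" where
  "acyclic_digraph G \<longleftrightarrow> \<not> (\<exists>p. pre_digraph.cycle G p)"

definition feedback_arc_set :: "('a, 'b) pre_digraph \<Rightarrow> 'b set \<Rightarrow> bool" where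
  "feedback_arc_set G F \<longleftrightarrow>
     F \<subseteq> arcs G \<and> acyclic_digraph (G\<lparr>arcs := arcs G - F\<rparr>)"

text \<open>
  If \<open>G\<close> is not acyclic then the empty set is not a feedback arc set, so it is immaterial
  that \<^const>\<open>partition_on\<close> requires nonempty parts; and if \<open>G\<close> is moreover finite, then
  the set under \<^const>\<open>Max\<close> is finite and contains \<open>1\<close>.
\<close>

definition fasd :: "('a, 'b) pre_digraph \<Rightarrow> enat" where
  "fasd G =
     (if acyclic_digraph G then \<infinity>
      else enat (Max {card P | P. partition_on (arcs G) P \<and> (\<forall>F \<in> P. feedback_arc_set G F)}))"

text \<open>
  Every finite oriented graph is isomorphic to one whose vertices are natural numbers and whose
  arcs are pairs of vertices, so these represent all oriented graphs. The infimum is a minimum,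
  since \<^typ>\<open>enat\<close> is well-ordered and the null graph is admissible.
\<close>

definition fasd_min :: "nat \<Rightarrow> nat \<Rightarrow> enat" where
  "fasd_min \<Delta> g =
     (INF D \<in> {D :: nat pair_pre_digraph.
         oriented_graph (with_proj D) \<and>
         (\<forall>v \<in> pverts D. degree (with_proj D) v \<le> \<Delta>) \<and>
         enat g \<le> directed_girth (with_proj D)}. fasd (with_proj D))"

end

theory Submission
  imports Defs
begin

text \<open>
  Suppose the arcs are partitioned into at least \<open>g\<close> feedback arc sets. A directed cycle of
  length \<open>g\<close> meets every part, hence it meets every part exactly once. This is contradictory
  in either of the following situations.

  \<^item> There is an odd number of \<open>g\<close>-cycles such that every arc lies on an even number of them:
    double counting the incidences of a single part with these cycles gives an odd and an even
    number. Two unions of nine cycles have this property, one for \<open>g = 4\<close> and one for \<open>g = 6\<close>.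

  \<^item> There are more than \<open>g\<close> arcs any two of which lie on a common \<open>g\<close>-cycle: they belong to
    distinct parts, but a \<open>g\<close>-cycle meets at most \<open>g\<close> parts. For \<open>g = 9\<close>, take three disjoint
    paths of lengths \<open>4\<close>, \<open>3\<close>, \<open>3\<close> and join the end of each path to the start of each other
    one, so that any two of the paths form a cycle of length \<open>9\<close>.
\<close>

section \<open>Cycles and feedback arc sets\<close>

lemma cycle_delete_arcs:
  assumes "pre_digraph.cycle G p" "set p \<inter> F = {}"
  shows "pre_digraph.cycle (G\<lparr>arcs := arcs G - F\<rparr>) p"
proof -
  let ?H = "G\<lparr>arcs := arcs G - F\<rparr>"
  \<comment> \<open>Both functions depend on \<open>G\<close> only through \<open>tail\<close> and
    \<open>head\<close>, which the update of \<open>arcs\<close> leaves alone.\<close>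
  have cas: "pre_digraph.cas ?H u q v = pre_digraph.cas G u q v" for u q v
    by (induction q arbitrary: u) (auto simp: pre_digraph.cas.simps)
  have verts: "pre_digraph.awalk_verts ?H u q = pre_digraph.awalk_verts G u q" for u q
    by (induction q arbitrary: u) (auto simp: pre_digraph.awalk_verts.simps)
  show ?thesis
    using assms unfolding pre_digraph.cycle_def pre_digraph.awalk_def cas verts by auto
qed

lemma feedback_arc_set_meets_cycle:
  assumes "feedback_arc_set G F" "pre_digraph.cycle G p"
  shows "F \<inter> set p \<noteq> {}"
  using assms cycle_delete_arcs[of G p F]
  unfolding feedback_arc_set_def acyclic_digraph_def by blast

lemma cycle_arcs_subset: "pre_digraph.cycle G p \<Longrightarrow> set p \<subseteq> arcs G"
  by (auto simp: pre_digraph.cycle_def pre_digraph.awalk_def)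

section \<open>How a partition into feedback arc sets meets one cycle\<close>

context
  fixes G :: "('a, 'b) pre_digraph" and P :: "'b set set" and p :: "'b list"
  assumes part: "partition_on (arcs G) P"
    and fas: "\<And>F. F \<in> P \<Longrightarrow> feedback_arc_set G F"
    and cyc: "pre_digraph.cycle G p"
begin

text \<open>The traces of the parts on the cycle are nonempty and pairwise disjoint, so distinct
  parts have distinct traces, and \<open>set p\<close> has only finitely many subsets. Finiteness of
  \<open>P\<close> thus comes from the cycle alone.\<close>

lemma finite_fas_partition: "finite P"
  and sum_card_fas_Int_cycle: "(\<Sum>F\<in>P. card (F \<inter> set p)) = card (set p)"
proof -
  have disj: "F \<inter> F' = {}" if "F \<in> P" "F' \<in> P" "F \<noteq> F'" for F F'
    using disjointD[OF partition_onD2[OF part] that] .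
  have meet: "F \<inter> set p \<noteq> {}" if "F \<in> P" for F
    using fas[OF that] cyc by (rule feedback_arc_set_meets_cycle)
  have "inj_on (\<lambda>F. F \<inter> set p) P"
  proof (rule inj_onI)
    fix F F' assume "F \<in> P" "F' \<in> P" "F \<inter> set p = F' \<inter> set p"
    with disj[of F F'] meet[of F] show "F = F'" by blast
  qed
  moreover have "finite ((\<lambda>F. F \<inter> set p) ` P)"
    by (rule finite_subset[of _ "Pow (set p)"]) auto
  ultimately show fin: "finite P"
    by (rule finite_imageD[rotated])
  have "(\<Sum>F\<in>P. card (F \<inter> set p)) = card (\<Union>F\<in>P. F \<inter> set p)"
    using disj fin by (subst card_UN_disjoint) auto
  also have "(\<Union>F\<in>P. F \<inter> set p) = set p"
    using cycle_arcs_subset[OF cyc] partition_onD1[OF part] by blast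
  finally show "(\<Sum>F\<in>P. card (F \<inter> set p)) = card (set p)" .
qed

lemma card_fas_Int_cycle_ge_1: "F \<in> P \<Longrightarrow> 1 \<le> card (F \<inter> set p)"
  using feedback_arc_set_meets_cycle[OF fas cyc] by (simp add: Suc_le_eq card_gt_0_iff)

lemma card_fas_partition_le: "card P \<le> length p"
proof -
  have "card P \<le> (\<Sum>F\<in>P. card (F \<inter> set p))"
    using sum_mono[of P "\<lambda>_. 1", OF card_fas_Int_cycle_ge_1] by simp
  also have "\<dots> \<le> length p"
    by (simp add: sum_card_fas_Int_cycle card_length)
  finally show ?thesis .
qed

text \<open>Equality case of the preceding bound: the traces are nonempty and their sizes add up to
  at most \<open>length p\<close>, so none can have two arcs.\<close>

lemma card_fas_Int_shortest_cycle:
  assumes "length p \<le> card P" "F \<in> P"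
  shows "card (F \<inter> set p) = 1"
proof (rule ccontr)
  assume "card (F \<inter> set p) \<noteq> 1"
  with card_fas_Int_cycle_ge_1[OF assms(2)] have "1 < card (F \<inter> set p)" by simp
  then have "(\<Sum>F\<in>P. 1) < (\<Sum>F\<in>P. card (F \<inter> set p))"
    using finite_fas_partition assms(2) card_fas_Int_cycle_ge_1
    by (intro sum_strict_mono_ex1) auto
  then show False
    using assms(1) card_length[of p] by (simp add: sum_card_fas_Int_cycle)
qed

end

text \<open>\<open>Max\<close> is meaningful here: the trivial partition makes its argument
  nonempty, and the bound in the premise makes it finite. The cycle rules out the value
  \<infinity>.\<close>

lemma fasd_less:
  assumes "pre_digraph.cycle G p"
    and "\<And>P. partition_on (arcs G) P \<Longrightarrow> (\<And>F. F \<in> P \<Longrightarrow> feedback_arc_set G F) \<Longrightarrow> card P < g"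
  shows "fasd G < enat g"
proof -
  let ?S = "{card P | P. partition_on (arcs G) P \<and> (\<forall>F \<in> P. feedback_arc_set G F)}"
  have cyclic: "\<not> acyclic_digraph G"
    using assms(1) by (auto simp: acyclic_digraph_def)
  have "arcs G \<noteq> {}"
    using assms(1) by (auto simp: pre_digraph.cycle_def pre_digraph.awalk_def)
  then have "partition_on (arcs G) {arcs G}"
    by (rule partition_on_space)
  moreover have "feedback_arc_set G (arcs G)"
    by (auto simp: feedback_arc_set_def acyclic_digraph_def pre_digraph.cycle_def
        pre_digraph.awalk_def)
  ultimately have "card {arcs G} \<in> ?S" by blast
  moreover have less: "\<forall>k \<in> ?S. k < g" using assms(2) by blast
  moreover have "finite ?S"
    using less by (intro finite_subset[of ?S "{..<g}"]) auto
  ultimately have "Max ?S < g" by (subst Max_less_iff) auto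
  with cyclic show ?thesis by (simp add: fasd_def)
qed

section \<open>The parity criterion and the clique criterion\<close>

lemma fasd_less_if_even_cover:
  assumes cyc: "\<And>p. p \<in> set ps \<Longrightarrow> pre_digraph.cycle G p \<and> length p = g"
    and "odd (length ps)"
    and even: "\<And>e. e \<in> arcs G \<Longrightarrow> even (length (filter (\<lambda>p. e \<in> set p) ps))"
    and fin: "finite (arcs G)"
  shows "fasd G < enat g"
proof -
  from \<open>odd (length ps)\<close> obtain p where p: "p \<in> set ps"
    by (cases ps) auto
  show ?thesis
  proof (rule fasd_less)
    show "pre_digraph.cycle G p" using cyc p by blast
    fix P assume P: "partition_on (arcs G) P" "\<And>F. F \<in> P \<Longrightarrow> feedback_arc_set G F"
    show "card P < g"
    proof (rule ccontr)
      assume "\<not> card P < g"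
      then have ge: "g \<le> card P" by simp
      have "p \<noteq> []" using cyc[OF p] by (auto simp: pre_digraph.cycle_def)
      with ge cyc[OF p] have "P \<noteq> {}" by auto
      then obtain F where F: "F \<in> P" by blast
      have sub: "F \<subseteq> arcs G" using P(2)[OF F] by (simp add: feedback_arc_set_def)
      \<comment> \<open>For infinite \<open>F\<close> the right-hand sum in \<open>count\<close>
        would be 0 by convention.\<close>
      have finF: "finite F" using fin sub by (rule finite_subset[rotated])
      have count: "(\<Sum>q\<leftarrow>qs. card (F \<inter> set q)) = (\<Sum>e\<in>F. length (filter (\<lambda>q. e \<in> set q) qs))"
        for qs
      proof (induction qs)
        case (Cons q qs)
        have "(\<Sum>e\<in>F. length (filter (\<lambda>q. e \<in> set q) (q # qs))) =
          (\<Sum>e\<in>F. (if e \<in> set q then 1 else 0) + length (filter (\<lambda>q. e \<in> set q) qs))"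
          by (intro sum.cong) auto
        also have "\<dots> = card (F \<inter> set q) + (\<Sum>e\<in>F. length (filter (\<lambda>q. e \<in> set q) qs))"
          using finF by (simp add: sum.distrib sum.If_cases)
        finally show ?case using Cons.IH by simp
      qed simp
      have "(\<Sum>q\<leftarrow>ps. card (F \<inter> set q)) = (\<Sum>q\<leftarrow>ps. 1)"
      proof (intro arg_cong[where f = sum_list] map_cong refl)
        fix q assume "q \<in> set ps"
        with cyc ge show "card (F \<inter> set q) = 1"
          by (intro card_fas_Int_shortest_cycle[OF P _ _ F]) auto
      qed
      also have "\<dots> = length ps" by (simp add: sum_list_triv)
      finally have "length ps = (\<Sum>e\<in>F. length (filter (\<lambda>q. e \<in> set q) ps))"
        by (simp add: count)
      moreover have "even (\<Sum>e\<in>F. length (filter (\<lambda>q. e \<in> set q) ps))"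
        using even sub by (intro dvd_sum) auto
      ultimately show False using \<open>odd (length ps)\<close> by simp
    qed
  qed
qed

lemma fasd_less_if_cycle_clique:
  assumes cyc: "\<And>p. p \<in> set ps \<Longrightarrow> pre_digraph.cycle G p \<and> length p = g"
    and "ps \<noteq> []"
    and clique: "\<And>e f. e \<in> K \<Longrightarrow> f \<in> K \<Longrightarrow> \<exists>p \<in> set ps. e \<in> set p \<and> f \<in> set p"
    and card: "g < card K"
  shows "fasd G < enat g"
proof -
  from \<open>ps \<noteq> []\<close> obtain p where p: "p \<in> set ps"
    by (cases ps) auto
  show ?thesis
  proof (rule fasd_less)
    show "pre_digraph.cycle G p" using cyc p by blast
    fix P assume P: "partition_on (arcs G) P" "\<And>F. F \<in> P \<Longrightarrow> feedback_arc_set G F"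
    show "card P < g"
    proof (rule ccontr)
      assume "\<not> card P < g"
      then have ge: "g \<le> card P" by simp
      have "\<exists>F \<in> P. e \<in> F" if e: "e \<in> K" for e
      proof -
        \<comment> \<open>The case \<open>f = e\<close> of the clique condition places
          \<open>e\<close> on a cycle, hence in \<open>arcs G\<close>.\<close>
        obtain q where "q \<in> set ps" "e \<in> set q" using clique[OF e e] by blast
        then have "e \<in> arcs G" using cyc cycle_arcs_subset[of G q] by blast
        then show ?thesis using partition_onD1[OF P(1)] by blast
      qed
      then obtain h where h: "\<And>e. e \<in> K \<Longrightarrow> h e \<in> P \<and> e \<in> h e" by metis
      have "inj_on h K"
      proof (rule inj_onI)
        fix e f assume ef: "e \<in> K" "f \<in> K" "h e = h f"
        with clique obtain q where q: "q \<in> set ps" "e \<in> set q" "f \<in> set q" by blast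
        have "card (h e \<inter> set q) = 1"
          using cyc[OF q(1)] ge h[OF ef(1)] by (intro card_fas_Int_shortest_cycle[OF P]) auto
        moreover have "e \<in> h e \<inter> set q" "f \<in> h e \<inter> set q"
          using h ef q by auto
        ultimately show "e = f" by (metis card_1_singletonE singletonD)
      qed
      moreover have "h ` K \<subseteq> P" using h by blast
      moreover have "finite P" using finite_fas_partition[OF P] cyc p by blast
      ultimately have "card K \<le> card P" by (rule card_inj_on_le)
      also have "card P \<le> g" using card_fas_partition_le[OF P] cyc p by blast
      finally show False using card by simp
    qed
  qed
qed

section \<open>Digraphs given as unions of cycles\<close>

text \<open>\<open>rotate1\<close> pairs the last vertex with the first, which supplies the closing
  arc.\<close>

definition closed_arcs :: "'a list \<Rightarrow> ('a \<times> 'a) list" where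
  "closed_arcs vs = zip vs (rotate1 vs)"

text \<open>The cycles may share arcs; \<open>remdups\<close> lets the list lengths in
  \<open>max_degree_le\<close> count each arc once.\<close>

definition arc_list :: "'a list list \<Rightarrow> ('a \<times> 'a) list" where
  "arc_list vss = remdups (concat (map closed_arcs vss))"

definition cycle_union :: "'a list list \<Rightarrow> 'a pair_pre_digraph" where
  "cycle_union vss = \<lparr>pverts = set (concat vss), parcs = set (arc_list vss)\<rparr>"

fun walk_ends :: "('a \<times> 'a) list \<Rightarrow> nat \<Rightarrow> 'a \<Rightarrow> 'a list" where
  "walk_ends es 0 u = [u]"
| "walk_ends es (Suc k) u =
     concat (map (\<lambda>e. if fst e = u then walk_ends es k (snd e) else []) es)"

text \<open>Asking this for every \<open>k\<close> from 1 to \<open>g - 1\<close> amounts to girth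
  at least \<open>g\<close>, since a shortest closed walk is a cycle; unlike cycles, closed walks
  are enumerated by a plain recursion.\<close>

definition no_closed_walk :: "'a list list \<Rightarrow> nat \<Rightarrow> bool" where
  "no_closed_walk vss k \<longleftrightarrow>
     list_all (\<lambda>u. u \<notin> set (walk_ends (arc_list vss) k u)) (remdups (concat vss))"

definition max_degree_le :: "'a list list \<Rightarrow> nat \<Rightarrow> bool" where
  "max_degree_le vss d \<longleftrightarrow>
     list_all (\<lambda>v. length (filter (\<lambda>e. snd e = v) (arc_list vss)) +
       length (filter (\<lambda>e. fst e = v) (arc_list vss)) \<le> d) (remdups (concat vss))"

lemma cycle_union_simps [simp]:
  "pverts (cycle_union vss) = set (concat vss)"
  "parcs (cycle_union vss) = set (arc_list vss)"
  by (simp_all add: cycle_union_def)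

lemma set_arc_list: "set (arc_list vss) = (\<Union>vs\<in>set vss. set (closed_arcs vs))"
  by (simp add: arc_list_def)

lemma length_closed_arcs [simp]: "length (closed_arcs vs) = length vs"
  by (simp add: closed_arcs_def)

lemma closed_arcs_ends: "(u, v) \<in> set (closed_arcs vs) \<Longrightarrow> u \<in> set vs \<and> v \<in> set vs"
  by (auto simp: closed_arcs_def dest: set_zip_leftD set_zip_rightD)

lemma cycle_union_ends:
  "e \<in> set (arc_list vss) \<Longrightarrow> fst e \<in> set (concat vss) \<and> snd e \<in> set (concat vss)"
  by (cases e) (auto simp: set_arc_list dest: closed_arcs_ends)

text \<open>\<open>closed_arcs (u # us)\<close> is the case \<open>v = u\<close>; keeping the end
  apart from the start lets the induction move the start.\<close>

lemma pcas_zip: "pcas u (zip (u # us) (us @ [v])) v"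
  by (induction us arbitrary: u) auto

lemma pawalk_verts_zip: "pawalk_verts u (zip (u # us) (us @ [v])) = u # us @ [v]"
  by (induction us arbitrary: u) auto

lemma cycle_closed_arcs:
  assumes "vs \<in> set vss" "distinct vs" "vs \<noteq> []"
  shows "pre_digraph.cycle (with_proj (cycle_union vss)) (closed_arcs vs)"
proof -
  obtain u us where vs: "vs = u # us" using assms(3) by (cases vs) auto
  have arcs: "closed_arcs vs = zip (u # us) (us @ [u])" by (simp add: closed_arcs_def vs)
  have "set (closed_arcs vs) \<subseteq> set (arc_list vss)" using assms(1) by (auto simp: set_arc_list)
  moreover have "u \<in> set (concat vss)" using assms(1) vs by force
  moreover have "pcas u (closed_arcs vs) u" unfolding arcs by (rule pcas_zip)
  \<comment> \<open>Without its first entry the vertex list is \<open>us @ [u]\<close>, a rotation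
    of \<open>vs\<close>.\<close>
  moreover have "distinct (tl (pawalk_verts u (closed_arcs vs)))"
    unfolding arcs pawalk_verts_zip using assms(2) vs by simp
  moreover have "closed_arcs vs \<noteq> []" by (simp add: arcs)
  ultimately show ?thesis
    unfolding pre_digraph.cycle_def pre_digraph.awalk_def
      cas_with_proj_eq awalk_verts_with_proj_eq with_proj_simps cycle_union_simps
    by blast
qed

lemma walk_ends_pcas:
  "set p \<subseteq> set es \<Longrightarrow> pcas u p v \<Longrightarrow> v \<in> set (walk_ends es (length p) u)"
  by (induction p arbitrary: u) force+

lemma no_closed_walkD:
  assumes "no_closed_walk vss k" "set p \<subseteq> set (arc_list vss)" "pcas u p u" "p \<noteq> []"
  shows "length p \<noteq> k"
proof
  assume "length p = k"
  with walk_ends_pcas[OF assms(2,3)] have "u \<in> set (walk_ends (arc_list vss) k u)" by simp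
  \<comment> \<open>As \<open>p\<close> is nonempty, \<open>u\<close> is the tail of its first arc
    and so one of the tested vertices.\<close>
  moreover have "u \<in> set (concat vss)"
    using assms(2-4) cycle_union_ends[of "hd p" vss] by (cases p) auto
  ultimately show False
    using assms(1) by (auto simp: no_closed_walk_def list_all_iff)
qed

lemma degree_cycle_union_le:
  assumes "max_degree_le vss d" "v \<in> set (concat vss)"
  shows "degree (with_proj (cycle_union vss)) v \<le> d"
proof -
  have "in_degree (with_proj (cycle_union vss)) v =
      card (set (filter (\<lambda>e. snd e = v) (arc_list vss)))"
    "out_degree (with_proj (cycle_union vss)) v =
      card (set (filter (\<lambda>e. fst e = v) (arc_list vss)))"
    by (simp_all add: in_degree_def in_arcs_def out_degree_def out_arcs_def)
  then have "degree (with_proj (cycle_union vss)) v \<le>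
      length (filter (\<lambda>e. snd e = v) (arc_list vss)) +
      length (filter (\<lambda>e. fst e = v) (arc_list vss))"
    unfolding degree_def by (simp only: add_mono card_length)
  also have "\<dots> \<le> d" using assms by (auto simp: max_degree_le_def list_all_iff)
  finally show ?thesis .
qed

lemma oriented_graph_cycle_union:
  assumes "no_closed_walk vss 1" "no_closed_walk vss 2"
  shows "oriented_graph (with_proj (cycle_union vss))"
proof -
  have loop: "(u, u) \<notin> set (arc_list vss)" for u
    using no_closed_walkD[OF assms(1), of "[(u, u)]" u] by auto
  have "(v, u) \<notin> set (arc_list vss)" if "(u, v) \<in> set (arc_list vss)" for u v
    using no_closed_walkD[OF assms(2), of "[(u, v), (v, u)]" u] that by auto
  moreover have "pair_digraph (cycle_union vss)"
    using loop cycle_union_ends[of _ vss] by unfold_locales auto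
  then interpret pair_digraph "cycle_union vss" .
  have "digraph (with_proj (cycle_union vss))" by unfold_locales
  ultimately show ?thesis
    by (auto simp: oriented_graph_def oriented_graph_axioms_def)
qed

lemma directed_girth_cycle_union_ge:
  assumes "list_all (no_closed_walk vss) [1..<g]"
  shows "enat g \<le> directed_girth (with_proj (cycle_union vss))"
  unfolding directed_girth_def
proof (rule INF_greatest)
  fix p assume "p \<in> {p. pre_digraph.cycle (with_proj (cycle_union vss)) p}"
  then obtain u where p: "set p \<subseteq> set (arc_list vss)" "pcas u p u" "p \<noteq> []"
    by (auto simp: pre_digraph.cycle_def pre_digraph.awalk_def cas_with_proj_eq)
  have "g \<le> length p"
  proof (rule ccontr)
    assume "\<not> g \<le> length p"
    \<comment> \<open>The range starts at 1 because the empty walk is closed but is not a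
      cycle.\<close>
    then have "length p \<in> set [1..<g]" using p(3) by (cases p) auto
    with assms have "no_closed_walk vss (length p)" by (simp only: list_all_iff)
    from no_closed_walkD[OF this p] show False by simp
  qed
  then show "enat g \<le> enat (length p)" by simp
qed

section \<open>Executable criteria for \<open>fasd_min\<close>\<close>

lemma fasd_min_le_cycle_union:
  fixes vss :: "nat list list"
  assumes "max_degree_le vss d" "list_all (no_closed_walk vss) [1..<g]" "3 \<le> g"
  shows "fasd_min d g \<le> fasd (with_proj (cycle_union vss))"
proof -
  \<comment> \<open>Since \<open>3 \<le> g\<close>, the girth test covers lengths 1 and 2, that is,
    loops and directed 2-cycles.\<close>
  have "no_closed_walk vss 1" "no_closed_walk vss 2"
    using assms(2,3) by (simp_all add: list_all_iff)
  then have "oriented_graph (with_proj (cycle_union vss))"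
    by (rule oriented_graph_cycle_union)
  moreover have "\<forall>v \<in> pverts (cycle_union vss). degree (with_proj (cycle_union vss)) v \<le> d"
    using degree_cycle_union_le[OF assms(1)] by simp
  ultimately show ?thesis
    unfolding fasd_min_def using directed_girth_cycle_union_ge[OF assms(2)]
    by (intro INF_lower CollectI conjI)
qed

definition cycles_of_length :: "'a list list \<Rightarrow> nat \<Rightarrow> bool" where
  "cycles_of_length vss g \<longleftrightarrow> list_all (\<lambda>vs. distinct vs \<and> length vs = g) vss"

lemma cycles_of_lengthD:
  assumes "cycles_of_length vss g" "0 < g" "p \<in> set (map closed_arcs vss)"
  shows "pre_digraph.cycle (with_proj (cycle_union vss)) p \<and> length p = g"
  using assms by (auto simp: cycles_of_length_def list_all_iff intro!: cycle_closed_arcs)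

lemma fasd_min_less_if_even_cover:
  fixes vss :: "nat list list"
  assumes "max_degree_le vss d" "list_all (no_closed_walk vss) [1..<g]" "3 \<le> g"
    and "cycles_of_length vss g" "odd (length vss)"
    and "list_all (\<lambda>e. even (length (filter (\<lambda>p. e \<in> set p) (map closed_arcs vss))))
      (arc_list vss)"
  shows "fasd_min d g < enat g"
proof (rule le_less_trans[OF fasd_min_le_cycle_union[OF assms(1-3)]])
  show "fasd (with_proj (cycle_union vss)) < enat g"
    using assms cycles_of_lengthD[OF assms(4)]
    by (intro fasd_less_if_even_cover[where ps = "map closed_arcs vss"])
      (auto simp: list_all_iff)
qed

lemma fasd_min_less_if_cycle_clique:
  fixes vss :: "nat list list"
  assumes "max_degree_le vss d" "list_all (no_closed_walk vss) [1..<g]" "3 \<le> g"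
    and "cycles_of_length vss g" "vss \<noteq> []"
    and "list_all (\<lambda>e. list_all (\<lambda>f.
      list_ex (\<lambda>p. e \<in> set p \<and> f \<in> set p) (map closed_arcs vss)) es) es"
    and "distinct es" "g < length es"
  shows "fasd_min d g < enat g"
proof (rule le_less_trans[OF fasd_min_le_cycle_union[OF assms(1-3)]])
  show "fasd (with_proj (cycle_union vss)) < enat g"
  proof (rule fasd_less_if_cycle_clique[where ps = "map closed_arcs vss" and K = "set es"])
    show "g < card (set es)" using assms(7,8) by (simp add: distinct_card)
    fix e f assume "e \<in> set es" "f \<in> set es"
    with assms(6) show "\<exists>p \<in> set (map closed_arcs vss). e \<in> set p \<and> f \<in> set p"
      by (simp add: list_all_iff list_ex_iff)
  qed (use assms cycles_of_lengthD[OF assms(4)] in auto)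
qed

section \<open>The three digraphs\<close>

text \<open>\<open>cycles4\<close> and \<open>cycles6\<close> were found by a random computer search.\<close>

definition cycles4 :: "nat list list" where
  "cycles4 =
    [[1,7,5,2], [1,7,4,6], [2,4,6,5], [0,1,7,4], [0,1,7,5], [1,7,3,6], [0,3,2,4], [1,7,3,2],
     [0,3,6,5]]"

definition cycles6 :: "nat list list" where
  "cycles6 =
    [[0,11,7,1,5,6], [1,9,4,3,11,7], [0,9,4,8,5,6], [0,9,12,8,5,6], [2,4,8,5,6,10],
     [1,5,6,10,2,7], [0,11,12,8,5,6], [2,4,3,11,12,10], [1,9,12,10,2,7]]"

text \<open>The three paths are \<open>0, \<dots>, 4\<close> and \<open>5, \<dots>, 8\<close> and \<open>9, \<dots>, 12\<close>.\<close>

definition cycles9 :: "nat list list" where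
  "cycles9 = [[0,1,2,3,4,5,6,7,8], [0,1,2,3,4,9,10,11,12], [5,6,7,8,9,10,11,12,13]]"

text \<open>These are the 4 + 3 + 3 = 10 arcs of the paths, one more than \<open>g\<close>, without
  the joining arcs. The extra vertex 13 lengthens the way from 12 to 5, so that the two short paths
  also form a cycle of length 9 and not 8.\<close>

definition clique9 :: "(nat \<times> nat) list" where
  "clique9 = [(0,1), (1,2), (2,3), (3,4), (5,6), (6,7), (7,8), (9,10), (10,11), (11,12)]"

lemma fasd_min_5_4: "fasd_min 5 4 < enat 4"
  by (rule fasd_min_less_if_even_cover[of cycles4]) code_simp+

lemma fasd_min_4_6: "fasd_min 4 6 < enat 6"
  by (rule fasd_min_less_if_even_cover[of cycles6]) code_simp+

lemma fasd_min_3_9: "fasd_min 3 9 < enat 9"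
  by (rule fasd_min_less_if_cycle_clique[of cycles9 _ _ clique9]) code_simp+

theorem theorem9:
  shows "fasd_min 5 4 < 4 \<and> fasd_min 4 6 < 6 \<and> fasd_min 3 9 < 9"
  using fasd_min_5_4 fasd_min_4_6 fasd_min_3_9 by (simp add: numeral_eq_enat)

end
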